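(* Let $X$ be a compact Hausdorff, hereditarily normal, ccc space such that $g(X) \le \mathfrak{c}$. Then $|X| \le \mathfrak{c}$.
   Context: All spaces are assumed to be Hausdorff. A subset $D$ of $X$ is discrete if each of its points is isolated in the relative topology of $D$. The depth of $X$ is $g(X) = \sup\{|\overline{D}| : D \subset X \text{ discrete}\}$. A space is ccc if every family of pairwise disjoint non-empty open sets is countable. $\mathfrak{c}$ denotes the cardinality of the continuum. *)

theory Defs
  imports "HOL-Analysis.Analysis"
begin

unbundle cardinal_syntax

definition discrete_in :: "'a topology \<Rightarrow> 'a set \<Rightarrow> bool"
  where "discrete_in X D \<longleftrightarrow>
    D \<subseteq> topspace X \<and> (\<forall>x\<in>D. openin (subtopology X D) {x})"

definition ccc_space :: "'a topology \<Rightarrow> bool"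
  where "ccc_space X \<longleftrightarrow>
    (\<forall>\<U>. (\<forall>U\<in>\<U>. openin X U \<and> U \<noteq> {}) \<and> pairwise disjnt \<U> \<longrightarrow> countable \<U>)"

text \<open>Cardinals are represented by cardinal orders, which are unique only up to \<open>=o\<close>.
  All cardinals below are at most that of the point type, so a supremum exists among the
  cardinal orders on that type; the lemma \<open>is_card_sup_ordLeq_iff\<close> shows that it is also
  the least upper bound among the cardinal orders on every other type.\<close>

definition is_card_sup :: "'a rel set \<Rightarrow> 'a rel \<Rightarrow> bool"
  where "is_card_sup R k \<longleftrightarrow> Card_order k \<and> (\<forall>r\<in>R. r \<le>o k) \<and>
    (\<forall>k'::'a rel. Card_order k' \<and> (\<forall>r\<in>R. r \<le>o k') \<longrightarrow> k \<le>o k')"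

definition depth :: "'a topology \<Rightarrow> 'a rel"
  where "depth X = (SOME k. is_card_sup {|X closure_of D| | D. discrete_in X D} k)"

lemma is_card_sup_exists:
  fixes R :: "'a rel set"
  assumes "\<forall>r\<in>R. Card_order r"
  shows "\<exists>k. is_card_sup R k"
proof -
  let ?K = "{k::'a rel. Card_order k \<and> (\<forall>r\<in>R. r \<le>o k)}"
  have "r \<le>o |UNIV::'a set|" if "r \<in> R" for r
  proof -
    have "r =o |Field r|"
      using assms that Card_order_iff_ordIso_card_of by blast
    moreover have "|Field r| \<le>o |UNIV::'a set|"
      by (rule card_of_mono1) simp
    ultimately show ?thesis
      by (rule ordIso_ordLeq_trans)
  qed
  then have "|UNIV::'a set| \<in> ?K"
    using card_of_Card_order by blast
  then obtain k where "k \<in> ?K" "\<forall>k'\<in>?K. k \<le>o k'"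
    using exists_minim_Card_order[of ?K] by blast
  then show ?thesis
    unfolding is_card_sup_def by blast
qed

lemma is_card_sup_ordLeq_iff:
  fixes R :: "'a rel set" and c :: "'b rel"
  assumes k: "is_card_sup R k" and c: "Card_order c"
  shows "k \<le>o c \<longleftrightarrow> (\<forall>r\<in>R. r \<le>o c)"
proof
  assume "k \<le>o c"
  then show "\<forall>r\<in>R. r \<le>o c"
    using k ordLeq_transitive unfolding is_card_sup_def by blast
next
  assume R: "\<forall>r\<in>R. r \<le>o c"
  have "Card_order k"
    using k by (simp add: is_card_sup_def)
  then have k_UNIV: "k \<le>o |UNIV::'a set|"
    using Card_order_iff_ordIso_card_of card_of_mono1[of "Field k" UNIV]
      ordIso_ordLeq_trans by blast
  have "|UNIV::'a set| \<le>o c \<or> c \<le>o |UNIV::'a set|"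
    using ordLeq_total[of "|UNIV::'a set|" c] c card_of_Well_order
    by (auto simp: card_order_on_def)
  then show "k \<le>o c"
  proof
    assume "|UNIV::'a set| \<le>o c"
    with k_UNIV show ?thesis
      by (rule ordLeq_transitive)
  next
    assume "c \<le>o |UNIV::'a set|"
    then have "|Field c| \<le>o |UNIV::'a set|"
      using c Card_order_iff_ordIso_card_of ordIso_symmetric ordIso_ordLeq_trans by blast
    then obtain f where "inj_on f (Field c)" "f ` Field c \<subseteq> (UNIV::'a set)"
      using card_of_ordLeq[of "Field c" "UNIV::'a set"] by blast
    then have "|Field c| =o |f ` Field c|"
      using card_of_ordIso inj_on_imp_bij_betw by blast
    then have cA: "c =o |f ` Field c|"
      using c Card_order_iff_ordIso_card_of ordIso_transitive by blast
    then have "\<forall>r\<in>R. r \<le>o |f ` Field c|"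
      using R ordLeq_ordIso_trans by blast
    then have "k \<le>o |f ` Field c|"
      using k card_of_Card_order unfolding is_card_sup_def by blast
    then show ?thesis
      using cA ordIso_symmetric ordLeq_ordIso_trans by blast
  qed
qed

lemma depth_is_card_sup:
  "is_card_sup {|X closure_of D| | D. discrete_in X D} (depth X)"
  unfolding depth_def
  by (rule someI_ex, rule is_card_sup_exists) (auto simp: card_of_Card_order)

end

(*
Idea.  Call U regular open if U is the interior of its closure.  The proof rests on the bound
c = |UNIV :: real set| for the number of regular open sets.

1. In a compact hereditarily normal space the points with a countable local pi-base are dense.
   If there were none in an open set U, take disjoint open sets W n in U and closed G_delta sets
   E n in W n.  As a closed G_delta set has a countable neighbourhood base, one gets arbitrarily
   long strictly descending chains of closed G_delta sets C that meet all E n.  For the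
   intersection D of a maximal such chain, the union of the D Int E n and the part outside D
   of the limit set of the E n are separated (like the two edges of a Tychonoff plank), but they
   have no disjoint neighbourhoods, because a maximal chain has no countable coinitial subset.
2. Together with ccc this gives a pi-base with at most c members, hence at most c regular open sets.
3. If D is discrete, each subset of D is the trace of a regular open set, so 2^|D| <= c.
4. Given a point p, choose for each x other than p a regular open R x containing x but not p.
   There is a discrete D such that the closure of D and the sets R x with x in D cover everything
   but p.  So p lies in the complement of the union of {R x | x in D}, which has at most
   c points since the closure of D does; and there are at most c such families of regular
   open sets, because c^|D| <= c.
*)

theory Submission
  imports Defs "HOL-Library.Countable_Set_Type"
begin

subsection \<open>Cardinalities bounded by the continuum\<close>

lemma real_ordIso_nat_sets: "|UNIV :: real set| =o |UNIV :: nat set set|"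
  using nat_sets_eqpoll_reals eqpoll_iff_card_of_ordIso ordIso_symmetric by blast

lemma infinite_real_set: "\<not> finite (UNIV :: real set)"
  using infinite_UNIV_char_0 .

lemma card_of_Pow_mono_ordLeq:
  assumes "|A| \<le>o |B|"
  shows "|Pow A| \<le>o |Pow B|"
proof -
  obtain f where "inj_on f A" "f ` A \<subseteq> B"
    using assms card_of_ordLeq[of A B] by blast
  then have "inj_on (image f) (Pow A)" "image f ` Pow A \<subseteq> Pow B"
    using inj_on_image_Pow by blast+
  then show ?thesis using card_of_ordLeq by blast
qed

lemma countable_imp_card_of_Pow_ordLeq_real:
  assumes "countable A"
  shows "|Pow A| \<le>o |UNIV :: real set|"
proof -
  have "|A| \<le>o |UNIV :: nat set|"
    using assms countable_card_of_nat by blast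
  then have "|Pow A| \<le>o |UNIV :: nat set set|"
    using card_of_Pow_mono_ordLeq[of A "UNIV :: nat set"] by simp
  then show ?thesis
    using real_ordIso_nat_sets ordIso_symmetric ordLeq_ordIso_trans by blast
qed

lemma countable_imp_card_of_ordLeq_real:
  assumes "countable A"
  shows "|A| \<le>o |UNIV :: real set|"
  using countable_imp_card_of_Pow_ordLeq_real[OF assms] card_of_Pow[of A]
    ordLess_imp_ordLeq ordLeq_transitive by blast

lemma card_of_Pow_Times_nat_ordLeq_real:
  assumes "|Pow S| \<le>o |UNIV :: real set|"
  shows "|Pow (S \<times> (UNIV :: nat set))| \<le>o |UNIV :: real set|"
proof (cases "finite S")
  case True
  then show ?thesis
    by (intro countable_imp_card_of_Pow_ordLeq_real) (auto intro: countable_finite)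
next
  case False
  then have "|UNIV :: nat set| \<le>o |S|"
    using infinite_iff_card_of_nat by blast
  then have "|S \<times> (UNIV :: nat set)| \<le>o |S|"
    using False card_of_Times_infinite[of S "UNIV :: nat set"] ordIso_iff_ordLeq by blast
  then show ?thesis
    using card_of_Pow_mono_ordLeq assms ordLeq_transitive by blast
qed

text \<open>This is the bound c^k <= c for all k with 2^k <= c at once. A small subset is enumerated
  by a proper initial segment of a well-order of the reals. Since members of \<open>R\<close> are
  coded by sets of naturals, the enumeration becomes a subset of the segment times nat.\<close>

lemma card_of_small_subsets_ordLeq_real:
  assumes "|R| \<le>o |UNIV :: real set|"
  shows "|{C. C \<subseteq> R \<and> |Pow C| \<le>o |UNIV :: real set| }| \<le>o |UNIV :: real set|"
proof -
  have "|R| \<le>o |UNIV :: nat set set|"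
    using assms real_ordIso_nat_sets ordLeq_ordIso_trans by blast
  then obtain e :: "_ \<Rightarrow> nat set" where e: "inj_on e R"
    using card_of_ordLeq[of R "UNIV :: nat set set"] by blast
  let ?r = "|UNIV :: real set|"
  let ?S = "\<lambda>a. underS ?r a"
  let ?I = "{a. |Pow (?S a \<times> (UNIV :: nat set))| \<le>o ?r}"
  \<comment> \<open>The section of \<open>T\<close> at \<open>x\<close> is the \<open>e\<close>-code
    of the member of \<open>R\<close> enumerated at \<open>x\<close>.\<close>
  define dec where "dec = (\<lambda>(a, T). (\<lambda>x. inv_into R e {n :: nat. (x, n) \<in> T}) ` ?S a)"
  have "C \<in> dec ` (SIGMA a:?I. Pow (?S a \<times> UNIV))"
    if C: "C \<subseteq> R" "|Pow C| \<le>o ?r" for C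
  proof -
    \<comment> \<open>A set is smaller than its power set, so \<open>C\<close> has fewer than c
      elements and hence the size of a proper initial segment.\<close>
    have "|C| <o ?r" using C(2) card_of_Pow ordLess_ordLeq_trans by blast
    then have "\<exists>a\<in>Field ?r. |C| =o Restr ?r (?S a)"
      by (rule iffD1[OF ordLess_iff_ordIso_Restr[OF card_of_Well_order card_of_Well_order]])
    then obtain a where "|C| =o Restr ?r (?S a)" by (elim bexE)
    then have "|Field |C| | =o |Field (Restr ?r (?S a))|" by (rule card_of_cong)
    moreover have "Field (Restr ?r (?S a)) = ?S a"
      using card_of_Well_order[of "UNIV :: real set"]
      by (intro Refl_Field_Restr2) (auto simp: order_on_defs intro: underS_Field)
    ultimately have "|C| =o |?S a|" by (simp add: Field_card_of)
    then obtain f where f: "bij_betw f (?S a) C"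
      using card_of_ordIso[of "?S a" C] ordIso_symmetric by blast
    have "|Pow (?S a)| \<le>o |Pow C|"
      using \<open>|C| =o |?S a|\<close> ordIso_iff_ordLeq card_of_Pow_mono_ordLeq by blast
    then have "a \<in> ?I"
      using C(2) card_of_Pow_Times_nat_ordLeq_real ordLeq_transitive by blast
    moreover
    define T where "T = {(x, n). x \<in> ?S a \<and> n \<in> e (f x)}"
    have "inv_into R e {n. (x, n) \<in> T} = f x" if "x \<in> ?S a" for x
    proof -
      have "f x \<in> R" using f that C(1) bij_betwE by blast
      then show ?thesis using that e unfolding T_def by simp
    qed
    then have "dec (a, T) = f ` ?S a" unfolding dec_def by simp
    then have "dec (a, T) = C" using f bij_betw_imp_surj_on by blast
    moreover have "T \<in> Pow (?S a \<times> UNIV)" unfolding T_def by auto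
    ultimately show ?thesis by blast
  qed
  then have "|{C. C \<subseteq> R \<and> |Pow C| \<le>o ?r}| \<le>o |dec ` (SIGMA a:?I. Pow (?S a \<times> UNIV))|"
    by (intro card_of_mono1) blast
  moreover have "|dec ` (SIGMA a:?I. Pow (?S a \<times> UNIV))| \<le>o |SIGMA a:?I. Pow (?S a \<times> (UNIV :: nat set))|"
    by (rule card_of_image)
  moreover have "|SIGMA a:?I. Pow (?S a \<times> (UNIV :: nat set))| \<le>o ?r"
    using infinite_real_set card_of_mono1[of ?I UNIV]
    by (intro card_of_Sigma_ordLeq_infinite) auto
  ultimately show ?thesis by (meson ordLeq_transitive)
qed

text \<open>Iterate \<open>F\<close> over countable subsets along omega_1, which is
  \<open>cardSuc natLeq\<close>. Each stage has at most c elements because c^omega = c, and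
  regularity of omega_1 places every countable subset of the union inside a single stage.\<close>

lemma countable_closing_off:
  fixes F :: "'b set \<Rightarrow> 'b set"
  assumes F: "\<And>C. countable C \<Longrightarrow> |F C| \<le>o |UNIV :: real set|"
  obtains A where "|A| \<le>o |UNIV :: real set|" "\<And>C. \<lbrakk>countable C; C \<subseteq> A\<rbrakk> \<Longrightarrow> F C \<subseteq> A"
proof -
  let ?c = "|UNIV :: real set|"
  let ?r = "cardSuc natLeq"
  have r: "Card_order ?r" "Well_order ?r"
    using cardSuc_Card_order[OF natLeq_Card_order] cardSuc_Well_order[OF natLeq_Card_order] by auto
  have "natLeq <o ?c"
  proof -
    have "natLeq =o |UNIV :: nat set|" using card_of_nat ordIso_symmetric by blast
    moreover have "|UNIV :: nat set| <o |Pow (UNIV :: nat set)|" by (rule card_of_Pow)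
    ultimately show ?thesis
      using real_ordIso_nat_sets ordIso_symmetric ordIso_ordLess_trans ordLess_ordIso_trans
      by (metis Pow_UNIV)
  qed
  then have "?r \<le>o ?c"
    using cardSuc_ordLess_ordLeq[OF natLeq_Card_order] card_of_Card_order by blast
  then have fieldr: "|Field ?r| \<le>o ?c"
    using card_of_Field_ordIso[OF r(1)] ordIso_ordLeq_trans by blast
  have wf: "wf (?r - Id)" using r(2) by (simp add: well_order_on_def)
  define G where "G = (\<lambda>A. \<Union>C\<in>{C. C \<subseteq> A \<and> countable C}. F C)"
  define A where "A = wfrec (?r - Id) (\<lambda>A i. \<Union>j\<in>underS ?r i. G (A j))"
  have A: "A i = (\<Union>j\<in>underS ?r i. G (A j))" for i
    unfolding A_def by (subst wfrec[OF wf]) (auto simp: cut_def underS_def)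
  have G: "|G B| \<le>o ?c" if "|B| \<le>o ?c" for B
  proof -
    have "|{C. C \<subseteq> B \<and> countable C}| \<le>o |{C. C \<subseteq> B \<and> |Pow C| \<le>o ?c}|"
      using countable_imp_card_of_Pow_ordLeq_real by (intro card_of_mono1) blast
    then have "|{C. C \<subseteq> B \<and> countable C}| \<le>o ?c"
      using card_of_small_subsets_ordLeq_real[OF that] ordLeq_transitive by blast
    then show ?thesis
      unfolding G_def using F infinite_real_set
      by (intro card_of_UNION_ordLeq_infinite) auto
  qed
  have card_A: "|A i| \<le>o ?c" for i
  proof (induction i rule: wf_induct_rule[OF wf])
    case (1 i)
    have "underS ?r i \<subseteq> Field ?r" by (auto intro: underS_Field)
    then have "|underS ?r i| \<le>o ?c"
      using card_of_mono1 fieldr ordLeq_transitive by blast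
    then show ?case
      using 1 G infinite_real_set unfolding A[of i]
      by (intro card_of_UNION_ordLeq_infinite) (auto simp: underS_def)
  qed
  let ?A = "\<Union>i\<in>Field ?r. A i"
  show ?thesis
  proof (rule that[of ?A])
    show "|?A| \<le>o ?c"
      using infinite_real_set fieldr card_A by (intro card_of_UNION_ordLeq_infinite) auto
    fix C assume C: "countable C" "C \<subseteq> ?A"
    have inf: "\<not> finite (Field natLeq)" by (simp add: Field_natLeq)
    have "relChain ?r A"
      unfolding relChain_def
    proof (intro allI impI)
      fix i j assume "(i, j) \<in> ?r"
      then have "underS ?r i \<subseteq> underS ?r j"
        using r(2) underS_incr[of ?r i j] by (auto simp: order_on_defs)
      then show "A i \<le> A j" unfolding A[of i] A[of j] by blast
    qed
    moreover have "|C| \<le>o natLeq" using C(1) countable_card_le_natLeq by blast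
    ultimately obtain i where i: "i \<in> Field ?r" "C \<subseteq> A i"
      using cardSuc_UNION[OF natLeq_Card_order inf] C(2) by blast
    \<comment> \<open>A stage collects only values from strictly earlier stages, so
      \<open>F C\<close> enters after stage \<open>i\<close>; an infinite cardinal has no last
      element, hence a later stage exists.\<close>
    have "\<not> finite (Field ?r)"
      using cardSuc_finite[OF natLeq_Card_order] inf by blast
    then obtain j where j: "j \<in> Field ?r" "i \<noteq> j" "(i, j) \<in> ?r"
      using infinite_Card_order_limit[OF r(1)] i(1) by blast
    have "F C \<subseteq> G (A i)" unfolding G_def using i(2) C(1) by blast
    also have "\<dots> \<subseteq> A j" unfolding A[of j] using j by (auto simp: underS_def)
    finally show "F C \<subseteq> ?A" using j(1) by blast
  qed
qed

text \<open>Zorn's lemma: a nonempty member of \<G> disjoint from every set of a maximal disjoint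
  subfamily could be added to it. Under ccc such a subfamily of nonempty open sets is
  countable.\<close>

lemma maximal_disjoint_subfamily:
  "\<exists>\<U>. \<U> \<subseteq> \<G> \<and> pairwise disjnt \<U> \<and> (\<forall>B\<in>\<G>. B \<noteq> {} \<longrightarrow> (\<exists>U\<in>\<U>. \<not> disjnt U B))"
proof -
  let ?P = "{\<U>. \<U> \<subseteq> \<G> \<and> pairwise disjnt \<U>}"
  have "\<Union>\<C> \<in> ?P" if "subset.chain ?P \<C>" for \<C>
  proof -
    have "\<Union>\<C> \<subseteq> \<G>" using that unfolding subset_chain_def by blast
    moreover have "pairwise disjnt (\<Union>\<C>)"
    proof (rule pairwiseI)
      fix A B assume "A \<in> \<Union>\<C>" "B \<in> \<Union>\<C>" "A \<noteq> B"
      then obtain \<U> \<V> where UV: "\<U> \<in> \<C>" "\<V> \<in> \<C>" "A \<in> \<U>" "B \<in> \<V>" by blast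
      then have "\<U> \<subseteq> \<V> \<or> \<V> \<subseteq> \<U>" using that unfolding subset_chain_def by blast
      then have "{A, B} \<subseteq> \<U> \<or> {A, B} \<subseteq> \<V>" using UV by blast
      moreover have "pairwise disjnt \<U>" "pairwise disjnt \<V>"
        using UV that unfolding subset_chain_def by blast+
      ultimately show "disjnt A B" using \<open>A \<noteq> B\<close> by (meson insert_subset pairwiseD)
    qed
    ultimately show ?thesis by simp
  qed
  then have "\<exists>M\<in>?P. \<forall>\<V>\<in>?P. M \<subseteq> \<V> \<longrightarrow> \<V> = M"
    by (rule subset_Zorn')
  then obtain \<U> where \<U>: "\<U> \<in> ?P" "\<forall>\<V>\<in>?P. \<U> \<subseteq> \<V> \<longrightarrow> \<V> = \<U>"
    by (elim bexE)
  have "\<exists>U\<in>\<U>. \<not> disjnt U B" if "B \<in> \<G>" "B \<noteq> {}" for B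
  proof (rule ccontr)
    assume no: "\<not> ?thesis"
    then have "pairwise disjnt (insert B \<U>)"
      using \<U>(1) disjnt_sym by (auto simp: pairwise_insert)
    then have "insert B \<U> \<in> ?P" using \<U>(1) that(1) by blast
    with \<U>(2) have "\<U> \<subseteq> insert B \<U> \<longrightarrow> insert B \<U> = \<U>" by (rule bspec)
    then have "B \<in> \<U>" by blast
    then show False using no that(2) by (auto simp: disjnt_def)
  qed
  then show ?thesis using \<U>(1) by (intro exI[of _ \<U>]) simp
qed

subsection \<open>Points of countable pi-character\<close>

text \<open>If no \<open>C i\<close> lay in \<open>W\<close>, directedness would give the finite
  intersection property to the \<open>C i\<close> together with the complement of \<open>W\<close>,
  and a common point would contradict \<open>sub\<close>.\<close>

lemma compact_space_directed_INT_subset: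
  assumes "compact_space X" and clo: "\<And>i. i \<in> I \<Longrightarrow> closedin X (C i)"
    and dir: "\<And>i j. \<lbrakk>i \<in> I; j \<in> I\<rbrakk> \<Longrightarrow> \<exists>k\<in>I. C k \<subseteq> C i \<inter> C j"
    and "I \<noteq> {}" and W: "openin X W" and sub: "(\<Inter>i\<in>I. C i) \<subseteq> W"
  shows "\<exists>i\<in>I. C i \<subseteq> W"
proof (rule ccontr)
  assume no: "\<not> (\<exists>i\<in>I. C i \<subseteq> W)"
  let ?U = "insert (topspace X - W) (C ` I)"
  have fip: "\<Inter>\<F> \<noteq> {}" if \<F>: "finite \<F>" "\<F> \<subseteq> ?U" for \<F>
  proof -
    have below: "\<exists>i\<in>I. C i \<subseteq> (\<Inter>j\<in>J. C j)" if "finite J" "J \<subseteq> I" for J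
      using that
    proof (induction J rule: finite_induct)
      case empty
      then show ?case using \<open>I \<noteq> {}\<close> by auto
    next
      case (insert j J)
      then obtain i where i: "i \<in> I" "C i \<subseteq> (\<Inter>j\<in>J. C j)" by auto
      moreover have "j \<in> I" using insert.prems by simp
      ultimately obtain k where "k \<in> I" "C k \<subseteq> C j \<inter> C i" using dir by metis
      with i(2) show ?case by (intro bexI[of _ k]) auto
    qed
    have "finite (\<F> - {topspace X - W})" "\<F> - {topspace X - W} \<subseteq> C ` I"
      using \<F> by auto
    then obtain J where J: "finite J" "J \<subseteq> I" "\<F> - {topspace X - W} = C ` J"
      using finite_subset_image by metis
    obtain i where i: "i \<in> I" "C i \<subseteq> (\<Inter>j\<in>J. C j)"
      using below[OF J(1,2)] by blast
    obtain x where x: "x \<in> C i" "x \<notin> W" using no i(1) by blast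
    have "x \<in> topspace X" using x(1) clo[OF i(1)] closedin_subset by blast
    have "x \<in> A" if "A \<in> \<F>" for A
    proof (cases "A = topspace X - W")
      case False
      then have "A \<in> C ` J" using that J(3) by blast
      then show ?thesis using i(2) x(1) by blast
    qed (use x(2) \<open>x \<in> topspace X\<close> in blast)
    then show ?thesis by blast
  qed
  have "\<forall>A\<in>?U. closedin X A"
    using clo W by auto
  with fip have "\<Inter>?U \<noteq> {}"
    by (intro iffD1[OF compact_space_fip assms(1), THEN spec, THEN mp]) simp
  then show False using sub by blast
qed

section \<open>Closed G_delta sets in compact Hausdorff spaces\<close>

lemma gdelta_in_continuous_atMost:
  assumes "continuous_map X euclideanreal f"
  shows "gdelta_in X {x \<in> topspace X. f x \<le> a}"
proof -
  have op: "openin X {x \<in> topspace X. f x < b}" for b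
    using openin_continuous_map_preimage[OF assms, of "{..<b}"] by simp
  have "{x \<in> topspace X. f x \<le> a} = (\<Inter>n::nat. {x \<in> topspace X. f x < a + inverse (Suc n)})"
  proof (intro equalityI subsetI INT_I)
    fix x assume x: "x \<in> (\<Inter>n::nat. {x \<in> topspace X. f x < a + inverse (Suc n)})"
    have "f x \<le> a"
    proof (rule ccontr)
      assume "\<not> f x \<le> a"
      then obtain n where "inverse (Suc n) < f x - a"
        using reals_Archimedean[of "f x - a"] by auto
      moreover have "f x < a + inverse (Suc n)" using x by blast
      ultimately show False by linarith
    qed
    then show "x \<in> {x \<in> topspace X. f x \<le> a}" using x by auto
  next
    fix x and n :: nat assume "x \<in> {x \<in> topspace X. f x \<le> a}"
    moreover have "0 < inverse (real (Suc n))" by simp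
    ultimately show "x \<in> {x \<in> topspace X. f x < a + inverse (real (Suc n))}"
      unfolding mem_Collect_eq by linarith
  qed
  moreover have "gdelta_in X (\<Inter>n::nat. {x \<in> topspace X. f x < a + inverse (Suc n)})"
    by (intro gdelta_in_Inter) (auto intro: open_imp_gdelta_in op)
  ultimately show ?thesis by simp
qed

text \<open>The three sets are sublevel sets of a Urysohn function that is 0 at \<open>p\<close> and
  1 off \<open>W\<close>. As the complement of \<open>V\<close> is a G_delta, removing
  \<open>V\<close> from a closed G_delta set leaves a closed G_delta set.\<close>

lemma closed_gdelta_neighbourhood:
  assumes "compact_space X" "Hausdorff_space X" and W: "openin X W" "p \<in> W"
  obtains U F V where "openin X U" "closedin X F" "openin X V"
    "p \<in> U" "U \<subseteq> F" "F \<subseteq> V" "V \<subseteq> W" "gdelta_in X F" "gdelta_in X (topspace X - V)"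
proof -
  have normal: "normal_space X"
    using assms compact_Hausdorff_or_regular_imp_normal_space by blast
  have p: "p \<in> topspace X" using W openin_subset by blast
  have "closedin X {p}"
    using p assms(2) by (simp add: closedin_Hausdorff_singleton)
  moreover have "closedin X (topspace X - W)" using W by blast
  moreover have "disjnt {p} (topspace X - W)" using W by (auto simp: disjnt_def)
  ultimately obtain f where f: "continuous_map X euclideanreal f"
      "f ` {p} \<subseteq> {0}" "f ` (topspace X - W) \<subseteq> {1}"
    using Urysohn_lemma_alt[OF normal, of "{p}" "topspace X - W" 0 1] by metis
  let ?U = "{x \<in> topspace X. f x < 1/4}"
  let ?F = "{x \<in> topspace X. f x \<le> 1/4}"
  let ?V = "{x \<in> topspace X. f x < 1/2}"
  have op: "openin X {x \<in> topspace X. f x < b}" for b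
    using openin_continuous_map_preimage[OF f(1), of "{..<b}"] by simp
  have cl: "closedin X {x \<in> topspace X. f x \<le> b}" for b
    using closedin_continuous_map_preimage[OF f(1), of "{..b}"] by simp
  \<comment> \<open>A superlevel set of \<open>f\<close> is a sublevel set of its negative.\<close>
  have "continuous_map X euclideanreal (\<lambda>x. - f x)"
    using f(1) by (intro continuous_intros)
  from gdelta_in_continuous_atMost[OF this, of "-1/2"]
  have "gdelta_in X {x \<in> topspace X. 1/2 \<le> f x}" by simp
  moreover have "{x \<in> topspace X. 1/2 \<le> f x} = topspace X - ?V" by auto
  ultimately have "gdelta_in X (topspace X - ?V)" by simp
  moreover have "?V \<subseteq> W"
  proof
    fix x assume x: "x \<in> ?V"
    show "x \<in> W"
    proof (rule ccontr)
      assume "x \<notin> W"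
      then have "f x = 1" using f(3) x by blast
      then show False using x by simp
    qed
  qed
  moreover have "p \<in> ?U" using f(2) p by simp
  moreover have "?U \<subseteq> ?F" "?F \<subseteq> ?V" by auto
  ultimately show ?thesis
    by (intro that[of ?U ?F ?V] op cl gdelta_in_continuous_atMost[OF f(1)])
qed

text \<open>Write \<open>H\<close> as the intersection of open sets \<open>G n\<close>. Normality
  gives open \<open>U n\<close> around \<open>H\<close> with the closure of each inside the
  preceding one and its \<open>G n\<close>. These closures intersect inside \<open>H\<close>, so by
  compactness one of them lies in any given open \<open>W\<close> around \<open>H\<close>.\<close>

lemma closed_gdelta_countable_nbhd_base:
  assumes "compact_space X" "Hausdorff_space X" and H: "closedin X H" "gdelta_in X H"
  obtains \<B> where "countable \<B>" "\<And>B. B \<in> \<B> \<Longrightarrow> openin X B \<and> H \<subseteq> B"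
    "\<And>W. \<lbrakk>openin X W; H \<subseteq> W\<rbrakk> \<Longrightarrow> \<exists>B\<in>\<B>. B \<subseteq> W"
proof -
  have normal: "normal_space X"
    using assms compact_Hausdorff_or_regular_imp_normal_space by blast
  obtain G where G: "\<And>n::nat. openin X (G n)" "\<Inter>(range G) = H"
    using H(2) unfolding gdelta_in_descending by blast
  have shrink: "\<exists>U'. openin X U' \<and> H \<subseteq> U' \<and> X closure_of U' \<subseteq> U \<inter> G n"
    if "openin X U" "H \<subseteq> U" for U n
  proof -
    have "closedin X (topspace X - U \<inter> G n)" using that(1) G(1) by blast
    moreover have "disjnt H (topspace X - U \<inter> G n)"
      using that(2) G(2) by (auto simp: disjnt_def)
    ultimately obtain U' where "openin X U'" "H \<subseteq> U'"
        "disjnt (topspace X - U \<inter> G n) (X closure_of U')"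
      using normal H(1) unfolding normal_space by metis
    then show ?thesis
      using closure_of_subset_topspace[of X U'] by (auto simp: disjnt_def)
  qed
  have "\<exists>U. (\<forall>n. openin X (U n) \<and> H \<subseteq> U n) \<and>
      (\<forall>n. X closure_of (U (Suc n)) \<subseteq> U n \<inter> G n)"
    using dependent_nat_choice[of "\<lambda>n U. openin X U \<and> H \<subseteq> U"
        "\<lambda>n U U'. X closure_of U' \<subseteq> U \<inter> G n"] shrink
      closedin_subset[OF H(1)] openin_topspace by metis
  then obtain U where U: "\<And>n. openin X (U n)" "\<And>n. H \<subseteq> U n"
      "\<And>n. X closure_of (U (Suc n)) \<subseteq> U n \<inter> G n"
    by blast
  have sub: "U n \<subseteq> X closure_of (U n)" for n
    by (intro closure_of_subset openin_subset U(1))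
  have "decseq U"
    using sub U(3) by (intro decseq_SucI) blast
  then have decU: "U n \<subseteq> U m" if "m \<le> n" for m n
    using that decseqD by blast
  have dec: "X closure_of (U n) \<subseteq> X closure_of (U m)" if "m \<le> n" for m n
    using decU[OF that] closure_of_mono by blast
  show ?thesis
  proof (rule that[of "range U"])
    fix W assume W: "openin X W" "H \<subseteq> W"
    have "\<Inter>(range (\<lambda>n. X closure_of (U n))) \<subseteq> \<Inter>(range G)"
      using U(3) by blast
    then have "\<Inter>(range (\<lambda>n. X closure_of (U n))) \<subseteq> W"
      using W(2) G(2) by blast
    moreover have "\<exists>k\<in>UNIV. X closure_of (U k) \<subseteq> X closure_of (U m) \<inter> X closure_of (U n)"
      for m n
      using dec[of m "max m n"] dec[of n "max m n"] by auto
    ultimately have "\<exists>n\<in>UNIV. X closure_of (U n) \<subseteq> W"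
      using W(1)
      by (rule_tac compact_space_directed_INT_subset[OF assms(1)]) simp_all
    then show "\<exists>B\<in>range U. B \<subseteq> W" using sub by blast
  qed (use U in auto)
qed

section \<open>Countable local pi-bases and the plank argument\<close>

definition countable_pi_character :: "'a topology \<Rightarrow> 'a \<Rightarrow> bool"
  where "countable_pi_character X p \<longleftrightarrow>
    (\<exists>\<B>. countable \<B> \<and> (\<forall>B\<in>\<B>. openin X B \<and> B \<noteq> {}) \<and>
      (\<forall>W. openin X W \<and> p \<in> W \<longrightarrow> (\<exists>B\<in>\<B>. B \<subseteq> W)))"

text \<open>The countable neighbourhood bases of all sets in \<H> form together a countable family
  of nonempty open sets, which is not a local pi-base at \<open>p\<close>. An open set around
  \<open>p\<close> that contains no member of this family contains no set of \<H> either.\<close>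

lemma not_countable_pi_character_avoid:
  assumes X: "compact_space X" "Hausdorff_space X" and p: "\<not> countable_pi_character X p"
    and "countable \<H>" and \<H>: "\<And>H. H \<in> \<H> \<Longrightarrow> closedin X H \<and> gdelta_in X H \<and> H \<noteq> {}"
  shows "\<exists>W. openin X W \<and> p \<in> W \<and> (\<forall>H\<in>\<H>. \<not> H \<subseteq> W)"
proof -
  have "\<exists>\<B>. countable \<B> \<and> (\<forall>B\<in>\<B>. openin X B \<and> H \<subseteq> B) \<and>
      (\<forall>W. openin X W \<and> H \<subseteq> W \<longrightarrow> (\<exists>B\<in>\<B>. B \<subseteq> W))" if "H \<in> \<H>" for H
    using closed_gdelta_countable_nbhd_base[OF X, of H] \<H>[OF that] by metis
  then obtain \<B> where \<B>: "\<And>H. H \<in> \<H> \<Longrightarrow> countable (\<B> H)"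
      "\<And>H B. \<lbrakk>H \<in> \<H>; B \<in> \<B> H\<rbrakk> \<Longrightarrow> openin X B \<and> H \<subseteq> B"
      "\<And>H W. \<lbrakk>H \<in> \<H>; openin X W; H \<subseteq> W\<rbrakk> \<Longrightarrow> \<exists>B\<in>\<B> H. B \<subseteq> W"
    by metis
  have "countable (\<Union>H\<in>\<H>. \<B> H)" using \<open>countable \<H>\<close> \<B>(1) by blast
  moreover have "\<forall>B\<in>(\<Union>H\<in>\<H>. \<B> H). openin X B \<and> B \<noteq> {}"
    using \<B>(2) \<H> by blast
  ultimately obtain W where W: "openin X W" "p \<in> W" "\<not> (\<exists>B\<in>(\<Union>H\<in>\<H>. \<B> H). B \<subseteq> W)"
    using p unfolding countable_pi_character_def by metis
  then have "\<not> H \<subseteq> W" if "H \<in> \<H>" for H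
    using \<B>(3)[OF that W(1)] that by blast
  then show ?thesis using W(1,2) by blast
qed

text \<open>This yields the next set of a descending chain: removing \<open>V\<close> leaves a part
  of every \<open>H n\<close>, yet loses a closed set \<open>F\<close> that meets infinitely many of
  them. Neighbourhoods that swallow no \<open>H n\<close> exist at each point of \<open>K\<close>;
  finitely many cover \<open>K\<close>, and by the pigeonhole principle one serves infinitely many
  \<open>n\<close>.\<close>

lemma uncountable_pi_character_split:
  assumes X: "compact_space X" "Hausdorff_space X"
    and K: "closedin X K" "\<And>p. p \<in> K \<Longrightarrow> \<not> countable_pi_character X p"
    and H: "\<And>n::nat. closedin X (H n) \<and> gdelta_in X (H n) \<and> H n \<noteq> {} \<and> H n \<subseteq> K"
  shows "\<exists>V F. openin X V \<and> gdelta_in X (topspace X - V) \<and> closedin X F \<and> F \<subseteq> V \<and>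
    (\<forall>n. \<not> H n \<subseteq> V) \<and> infinite {n. F \<inter> H n \<noteq> {}}"
proof -
  have "\<exists>U F V. openin X U \<and> closedin X F \<and> openin X V \<and> p \<in> U \<and> U \<subseteq> F \<and> F \<subseteq> V \<and>
      gdelta_in X (topspace X - V) \<and> (\<forall>n. \<not> H n \<subseteq> V)" if "p \<in> K" for p
  proof -
    have "countable (range H)"
      "\<And>A. A \<in> range H \<Longrightarrow> closedin X A \<and> gdelta_in X A \<and> A \<noteq> {}"
      using H by auto
    then have "\<exists>W. openin X W \<and> p \<in> W \<and> (\<forall>A\<in>range H. \<not> A \<subseteq> W)"
      by (rule not_countable_pi_character_avoid[OF X K(2)[OF that]])
    then obtain W where W: "openin X W" "p \<in> W" "\<forall>A\<in>range H. \<not> A \<subseteq> W" by blast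
    obtain U F V where "openin X U" "closedin X F" "openin X V"
      "p \<in> U" "U \<subseteq> F" "F \<subseteq> V" "V \<subseteq> W" "gdelta_in X (topspace X - V)"
      using closed_gdelta_neighbourhood[OF X W(1,2)] by metis
    moreover have "\<forall>n. \<not> H n \<subseteq> V" using W(3) \<open>V \<subseteq> W\<close> by blast
    ultimately show ?thesis by (intro exI[of _ U] exI[of _ F] exI[of _ V]) simp
  qed
  then obtain U F V where UFV: "\<And>p. p \<in> K \<Longrightarrow> openin X (U p) \<and> closedin X (F p) \<and> openin X (V p) \<and>
      p \<in> U p \<and> U p \<subseteq> F p \<and> F p \<subseteq> V p \<and> gdelta_in X (topspace X - V p) \<and> (\<forall>n. \<not> H n \<subseteq> V p)"
    by metis
  have "compactin X K" using X(1) K(1) closedin_compact_space by blast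
  moreover have "\<And>A. A \<in> U ` K \<Longrightarrow> openin X A" "K \<subseteq> \<Union>(U ` K)" using UFV by blast+
  ultimately obtain \<F> where \<F>: "finite \<F>" "\<F> \<subseteq> U ` K" "K \<subseteq> \<Union>\<F>"
    using compactinD by metis
  then obtain I where I: "finite I" "I \<subseteq> K" "\<F> = U ` I"
    using finite_subset_image by metis
  have "\<exists>i\<in>I. F i \<inter> H n \<noteq> {}" for n
  proof -
    obtain x where "x \<in> H n" "x \<in> K" using H by blast
    then obtain i where "i \<in> I" "x \<in> U i" using \<F> I by blast
    then show ?thesis using \<open>x \<in> H n\<close> UFV I by blast
  qed
  then obtain g where g: "\<And>n. g n \<in> I" "\<And>n. F (g n) \<inter> H n \<noteq> {}" by metis
  have "finite (range g)" using g(1) I(1) finite_subset[of "range g" I] by auto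
  then obtain n0 where "infinite {n. g n = g n0}"
    using pigeonhole_infinite[of "UNIV :: nat set" g] by auto
  moreover have "{n. g n = g n0} \<subseteq> {n. F (g n0) \<inter> H n \<noteq> {}}"
    using g(2) by (metis (mono_tags, lifting) mem_Collect_eq subsetI)
  ultimately have "infinite {n. F (g n0) \<inter> H n \<noteq> {}}" using infinite_super by blast
  moreover have "g n0 \<in> K" using g(1) I(2) by blast
  ultimately show ?thesis using UFV by (intro exI[of _ "V (g n0)"] exI[of _ "F (g n0)"]) simp
qed

text \<open>Without isolated points, every nonempty open subset of \<open>U\<close> contains two
  disjoint nonempty open sets. The recursion continues inside one of them and sets the other aside
  as \<open>W n\<close>.\<close>

lemma disjoint_open_sequence:
  assumes X: "Hausdorff_space X" and U: "openin X U" "U \<noteq> {}"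
    and nonisolated: "\<And>p. p \<in> U \<Longrightarrow> \<not> openin X {p}"
  obtains W where "\<And>n::nat. openin X (W n)" "\<And>n. W n \<noteq> {}" "\<And>n. W n \<subseteq> U"
    "\<And>m n. m \<noteq> n \<Longrightarrow> W m \<inter> W n = {}"
proof -
  have split: "\<exists>A' B. openin X A' \<and> A' \<noteq> {} \<and> A' \<subseteq> A \<and> openin X B \<and> B \<noteq> {} \<and> B \<subseteq> A \<and> A' \<inter> B = {}"
    if A: "openin X A" "A \<noteq> {}" "A \<subseteq> U" for A
  proof -
    obtain p where p: "p \<in> A" using A by blast
    have "A \<noteq> {p}" using nonisolated[of p] p A by auto
    then obtain q where q: "q \<in> A" "q \<noteq> p" using p by blast
    then obtain P Q where "openin X P" "openin X Q" "p \<in> P" "q \<in> Q" "disjnt P Q"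
      using X p openin_subset[OF A(1)] unfolding Hausdorff_space_def by (metis subsetD)
    then show ?thesis
      using A p q by (intro exI[of _ "A \<inter> P"] exI[of _ "A \<inter> Q"]) (auto simp: disjnt_def)
  qed
  have "\<exists>G. \<forall>n. (openin X (G n) \<and> G n \<noteq> {} \<and> G n \<subseteq> U) \<and>
      (G (Suc n) \<subseteq> G n \<and> (\<exists>B. openin X B \<and> B \<noteq> {} \<and> B \<subseteq> G n \<and> G (Suc n) \<inter> B = {}))"
  proof (rule dependent_nat_choice)
    show "\<exists>A. openin X A \<and> A \<noteq> {} \<and> A \<subseteq> U" using U by blast
    fix A and n :: nat
    assume A: "openin X A \<and> A \<noteq> {} \<and> A \<subseteq> U"
    then obtain A' B where "openin X A'" "A' \<noteq> {}" "A' \<subseteq> A" "openin X B" "B \<noteq> {}" "B \<subseteq> A" "A' \<inter> B = {}"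
      using split by metis
    moreover have "A' \<subseteq> U" using A \<open>A' \<subseteq> A\<close> by blast
    ultimately show "\<exists>A'. (openin X A' \<and> A' \<noteq> {} \<and> A' \<subseteq> U) \<and>
        A' \<subseteq> A \<and> (\<exists>B. openin X B \<and> B \<noteq> {} \<and> B \<subseteq> A \<and> A' \<inter> B = {})"
      by (intro exI[of _ A'] conjI exI[of _ B])
  qed
  then obtain G where "\<forall>n. (openin X (G n) \<and> G n \<noteq> {} \<and> G n \<subseteq> U) \<and>
      (G (Suc n) \<subseteq> G n \<and> (\<exists>B. openin X B \<and> B \<noteq> {} \<and> B \<subseteq> G n \<and> G (Suc n) \<inter> B = {}))"
    by (rule exE)
  then have G: "\<And>n. G n \<subseteq> U" "\<And>n. G (Suc n) \<subseteq> G n"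
      "\<And>n. \<exists>B. openin X B \<and> B \<noteq> {} \<and> B \<subseteq> G n \<and> G (Suc n) \<inter> B = {}"
    by simp_all
  then obtain W where W: "\<And>n. openin X (W n) \<and> W n \<noteq> {} \<and> W n \<subseteq> G n \<and> G (Suc n) \<inter> W n = {}"
    by metis
  have dec: "G n \<subseteq> G m" if "m \<le> n" for m n
    using lift_Suc_antimono_le[of G, OF G(2) that] .
  have less: "W m \<inter> W n = {}" if "m < n" for m n
    using dec[of "Suc m" n] W[of m] W[of n] that by auto
  have "W m \<inter> W n = {}" if "m \<noteq> n" for m n
    using less[of m n] less[of n m] that by (cases "m < n") auto
  then show ?thesis using that[of W] W G(1) by blast
qed

text \<open>The closures of the tails are a decreasing sequence of nonempty closed subsets of
  \<open>F\<close>.\<close>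

lemma compact_space_sequence_accumulation:
  assumes X: "compact_space X" and F: "closedin X F" and "infinite {n::nat. F \<inter> A n \<noteq> {}}"
  obtains y where "y \<in> F" "\<And>m. y \<in> X closure_of (\<Union>n\<in>{m..}. F \<inter> A n)"
proof -
  let ?C = "\<lambda>m. X closure_of (\<Union>n\<in>{m..}. F \<inter> A n)"
  have "?C m \<noteq> {}" for m
  proof -
    obtain n where "m \<le> n" "F \<inter> A n \<noteq> {}"
      using assms(3) unfolding infinite_nat_iff_unbounded_le by blast
    moreover have "(\<Union>n\<in>{m..}. F \<inter> A n) \<subseteq> topspace X"
      using closedin_subset[OF F] by blast
    ultimately show ?thesis
      using closure_of_subset[of "\<Union>n\<in>{m..}. F \<inter> A n" X] by fastforce
  qed
  moreover have "decseq ?C"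
    unfolding decseq_def by (intro allI impI closure_of_mono UN_mono) auto
  ultimately obtain y where y: "\<And>m. y \<in> ?C m"
    using compact_space_imp_nest[OF X, of ?C] by auto
  moreover have "?C 0 \<subseteq> F"
    using F by (intro closure_of_minimal) auto
  ultimately show ?thesis using that by blast
qed

lemma hereditarily_normal_countable_pi_character:
  assumes X: "compact_space X" "Hausdorff_space X" "hereditarily normal_space X"
    and U: "openin X U" "U \<noteq> {}"
  shows "\<exists>p\<in>U. countable_pi_character X p"
proof (rule ccontr)
  assume "\<not> ?thesis"
  then have npi: "\<not> countable_pi_character X p" if "p \<in> U" for p using that by blast
  obtain p0 where "p0 \<in> U" using U by blast
  \<comment> \<open>The closed set \<open>K\<close> supplies the compactness needed for splitting,
    while its points still lie in \<open>U\<close>.\<close>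
  then obtain U1 K where K: "openin X U1" "p0 \<in> U1" "U1 \<subseteq> K" "closedin X K" "K \<subseteq> U"
    using closed_gdelta_neighbourhood[OF X(1,2) U(1)] by (metis order_trans)
  have "\<not> openin X {p}" if "p \<in> U1" for p
  proof
    assume "openin X {p}"
    then have "countable_pi_character X p"
      unfolding countable_pi_character_def by (intro exI[of _ "{{p}}"]) auto
    then show False using npi that K by blast
  qed
  then obtain W where W: "\<And>n::nat. openin X (W n)" "\<And>n. W n \<noteq> {}" "\<And>n. W n \<subseteq> U1"
      "\<And>m n. m \<noteq> n \<Longrightarrow> W m \<inter> W n = {}"
    using disjoint_open_sequence[OF X(2) K(1)] K(2) by (metis empty_iff)
  have "\<exists>E. closedin X E \<and> gdelta_in X E \<and> E \<noteq> {} \<and> E \<subseteq> W n" for n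
    using W(1,2)[of n] closed_gdelta_neighbourhood[OF X(1,2) W(1)[of n]]
    by (metis all_not_in_conv subset_iff)
  then obtain E where E: "\<And>n. closedin X (E n)" "\<And>n. gdelta_in X (E n)" "\<And>n. E n \<noteq> {}"
      "\<And>n. E n \<subseteq> W n"
    by metis
  \<comment> \<open>The limit set of the sequence \<open>E\<close>. It misses every
    \<open>W n\<close>, because \<open>W n\<close> meets no \<open>E k\<close> with k > n.\<close>
  define L where "L = (\<Inter>m. X closure_of (\<Union>n\<in>{m..}. E n))"
  have LE: "W n \<inter> L = {}" for n
  proof -
    have "W n \<inter> (\<Union>k\<in>{Suc n..}. E k) = {}"
      using W(4)[of n] E(4) by (fastforce simp: disjoint_iff)
    then have "W n \<inter> X closure_of (\<Union>k\<in>{Suc n..}. E k) = {}"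
      using openin_Int_closure_of_eq_empty[OF W(1)] by blast
    then show ?thesis unfolding L_def by blast
  qed
  have closedL: "closedin X L" unfolding L_def by auto

  define \<Phi> where "\<Phi> = {C. closedin X C \<and> gdelta_in X C \<and> (\<forall>n. C \<inter> E n \<noteq> {})}"
  \<comment> \<open>The order asks for more than proper inclusion: a closed set that misses
    \<open>C'\<close> still meets \<open>C \<inter> E n\<close> for infinitely many
    \<open>n\<close>. By compactness these traces accumulate at a point of \<open>L\<close> outside
    \<open>C'\<close>, which drives the final contradiction.\<close>
  define lt where "lt C' C \<longleftrightarrow> C' \<subseteq> C \<and>
      (\<exists>F. closedin X F \<and> F \<inter> C' = {} \<and> infinite {n. F \<inter> (C \<inter> E n) \<noteq> {}})" for C' C
  have lt_irrefl: "\<not> lt C C" for C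
  proof
    assume "lt C C"
    then obtain F where F: "F \<inter> C = {}" "infinite {n. F \<inter> (C \<inter> E n) \<noteq> {}}"
      unfolding lt_def by blast
    have "{n. F \<inter> (C \<inter> E n) \<noteq> {}} = {}" using F(1) by blast
    then show False using F(2) by simp
  qed
  \<comment> \<open>Hence a set strictly below a lower bound of a chain is strictly below each of
    its members.\<close>
  have lt_mono: "lt C' D" if lt: "lt C' C" and "C \<subseteq> D" for C' C D
  proof -
    obtain F where F: "closedin X F" "F \<inter> C' = {}" "infinite {n. F \<inter> (C \<inter> E n) \<noteq> {}}"
      using lt unfolding lt_def by blast
    have "{n. F \<inter> (C \<inter> E n) \<noteq> {}} \<subseteq> {n. F \<inter> (D \<inter> E n) \<noteq> {}}" using \<open>C \<subseteq> D\<close> by blast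
    then have "infinite {n. F \<inter> (D \<inter> E n) \<noteq> {}}" using F(3) infinite_super by blast
    moreover have "C' \<subseteq> D" using lt \<open>C \<subseteq> D\<close> unfolding lt_def by blast
    ultimately show ?thesis unfolding lt_def using F(1,2) by blast
  qed
  have step: "\<exists>C'\<in>\<Phi>. lt C' C" if "C \<in> \<Phi>" for C
  proof -
    have CE: "closedin X (C \<inter> E n) \<and> gdelta_in X (C \<inter> E n) \<and> C \<inter> E n \<noteq> {} \<and> C \<inter> E n \<subseteq> K" for n
      using that E(1,2) E(4)[of n] W(3)[of n] K(3) unfolding \<Phi>_def
      by (auto intro: gdelta_in_Int)
    have "\<not> countable_pi_character X p" if "p \<in> K" for p
      using npi that K(5) by blast
    then have "\<exists>V F. openin X V \<and> gdelta_in X (topspace X - V) \<and> closedin X F \<and> F \<subseteq> V \<and>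
        (\<forall>n. \<not> C \<inter> E n \<subseteq> V) \<and> infinite {n. F \<inter> (C \<inter> E n) \<noteq> {}}"
      by (rule uncountable_pi_character_split[OF X(1,2) K(4) _ CE])
    then obtain V F where VF: "openin X V" "gdelta_in X (topspace X - V)" "closedin X F" "F \<subseteq> V"
        "\<forall>n. \<not> C \<inter> E n \<subseteq> V" "infinite {n. F \<inter> (C \<inter> E n) \<noteq> {}}"
      by blast
    have C: "C \<subseteq> topspace X" using that unfolding \<Phi>_def by (auto dest: closedin_subset)
    have "C \<inter> (topspace X - V) \<in> \<Phi>"
      using that VF(1,2,5) C unfolding \<Phi>_def by (auto intro!: gdelta_in_Int closedin_Int)
    moreover have "lt (C \<inter> (topspace X - V)) C"
      unfolding lt_def using VF(3,4,6) by blast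
    ultimately show ?thesis by blast
  qed

  obtain \<M> where \<M>: "pred_on.maxchain \<Phi> lt \<M>"
    using pred_on.Hausdorff[of \<Phi> lt] by blast
  have M\<Phi>: "\<M> \<subseteq> \<Phi>" and Mlt: "\<And>A B. \<lbrakk>A \<in> \<M>; B \<in> \<M>; A \<noteq> B\<rbrakk> \<Longrightarrow> lt A B \<or> lt B A"
    using \<M> unfolding pred_on.maxchain_def pred_on.chain_def by auto
  have Mchain: "A \<subseteq> B \<or> B \<subseteq> A" if "A \<in> \<M>" "B \<in> \<M>" for A B
    using Mlt[OF that] unfolding lt_def by blast
  \<comment> \<open>A lower bound in \<Phi> would have some \<open>D'\<close> strictly below it, and
    \<open>D'\<close> would extend the maximal chain.\<close>
  have nobound: "\<exists>M\<in>\<M>. \<not> D \<subseteq> M" if "D \<in> \<Phi>" for D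
  proof (rule ccontr)
    assume "\<not> ?thesis"
    then have D: "D \<subseteq> M" if "M \<in> \<M>" for M using that by blast
    obtain D' where D': "D' \<in> \<Phi>" "lt D' D" using step[OF \<open>D \<in> \<Phi>\<close>] by blast
    have "lt D' M" if "M \<in> \<M>" for M using lt_mono[OF D'(2) D[OF that]] .
    then have "pred_on.chain \<Phi> lt (insert D' \<M>)" "D' \<notin> \<M>"
      using D'(1) M\<Phi> Mlt lt_irrefl[of D'] unfolding pred_on.chain_def by blast+
    then show False using \<M> unfolding pred_on.maxchain_def by blast
  qed

  have clM: "closedin X M" if "M \<in> \<M>" for M using that M\<Phi> unfolding \<Phi>_def by blast
  have "topspace X \<in> \<Phi>"
    using E(1,3) closedin_subset unfolding \<Phi>_def by (fastforce simp: Int_absorb1)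
  then have Mne: "\<M> \<noteq> {}" using nobound by blast
  \<comment> \<open>Compactness along the chain, applied to the traces on a single
    \<open>E n\<close>.\<close>
  have shrink: "\<exists>M\<in>\<N>. M \<inter> E n \<subseteq> G"
    if \<N>: "\<N> \<subseteq> \<M>" "\<N> \<noteq> {}" "openin X G" "\<Inter>\<N> \<inter> E n \<subseteq> G" for \<N> n G
  proof -
    have "\<exists>K\<in>\<N>. K \<inter> E n \<subseteq> (M \<inter> E n) \<inter> (N \<inter> E n)" if "M \<in> \<N>" "N \<in> \<N>" for M N
    proof -
      have "M \<subseteq> N \<or> N \<subseteq> M" using Mchain that \<N>(1) by blast
      then show ?thesis using that by blast
    qed
    moreover have "closedin X (M \<inter> E n)" if "M \<in> \<N>" for M
      using that \<N>(1) clM E(1) by blast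
    moreover have "(\<Inter>M\<in>\<N>. M \<inter> E n) \<subseteq> G" using \<N>(2,4) by blast
    ultimately show ?thesis
      using \<N>(2,3)
      by (rule_tac compact_space_directed_INT_subset[OF X(1)]) simp_all
  qed

  define Q where "Q = (\<Union>n. \<Inter>\<M> \<inter> E n)"
  have closedIM: "closedin X (\<Inter>\<M>)" using Mne clM by blast
  have Qtop: "Q \<subseteq> topspace X" unfolding Q_def using E(1) closedin_subset by blast
  have "separatedin X Q (L - \<Inter>\<M>)"
  proof -
    have "X closure_of Q \<subseteq> \<Inter>\<M>" using closedIM by (intro closure_of_minimal) (auto simp: Q_def)
    moreover have "X closure_of (L - \<Inter>\<M>) \<subseteq> L" using closedL by (intro closure_of_minimal) auto
    moreover have "Q \<inter> L = {}" unfolding Q_def using LE E(4) by blast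
    ultimately show ?thesis
      unfolding separatedin_def using Qtop closedin_subset[OF closedL] by blast
  qed
  then obtain G V where G: "openin X G" "openin X V" "Q \<subseteq> G" "L - \<Inter>\<M> \<subseteq> V" "disjnt G V"
    using X(3) unfolding hereditarily_normal_separation by metis
  have "\<exists>M\<in>\<M>. M \<inter> E n \<subseteq> G" for n
    using shrink[of \<M> G n] Mne G(1,3) unfolding Q_def by blast
  \<comment> \<open>Only countably many chain members are chosen, so their intersection is again a
    closed G_delta set. Once it is known to meet every \<open>E n\<close>, it belongs to \<Phi> and
    cannot be a lower bound of the chain.\<close>
  then obtain M where M: "\<And>n. M n \<in> \<M>" "\<And>n. M n \<inter> E n \<subseteq> G" by metis
  have "\<Inter>(range M) \<inter> E n \<noteq> {}" for n
  proof
    assume "\<Inter>(range M) \<inter> E n = {}"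
    \<comment> \<open>Take the empty set as the open set: an empty intersection would already make
      the trace of one \<open>M n\<close> empty.\<close>
    then have "\<exists>N\<in>range M. N \<inter> E n \<subseteq> {}"
      using M(1) by (intro shrink) auto
    then show False using M(1) M\<Phi> unfolding \<Phi>_def by blast
  qed
  moreover have "gdelta_in X (\<Inter>(range M))"
    using M(1) M\<Phi> unfolding \<Phi>_def by (intro gdelta_in_Inter) auto
  moreover have "closedin X (\<Inter>(range M))" using M(1) clM by blast
  ultimately have "\<Inter>(range M) \<in> \<Phi>" unfolding \<Phi>_def by blast
  then obtain M1 where M1: "M1 \<in> \<M>" "\<not> \<Inter>(range M) \<subseteq> M1" using nobound by blast
  \<comment> \<open>So one chain member lies below all \<open>M n\<close>, and all its traces on the
    \<open>E n\<close> lie in \<open>G\<close>.\<close>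
  have M1sub: "M1 \<subseteq> M n" for n using Mchain[OF M1(1) M(1)[of n]] M1(2) by blast
  obtain M2 where M2: "M2 \<in> \<M>" "\<not> M1 \<subseteq> M2" using nobound M1(1) M\<Phi> by blast
  then have "lt M2 M1" using Mlt[of M1 M2] M1(1) unfolding lt_def by blast
  then obtain F where F: "closedin X F" "F \<inter> M2 = {}" "infinite {n. F \<inter> (M1 \<inter> E n) \<noteq> {}}"
    unfolding lt_def by blast
  \<comment> \<open>The traces lost between \<open>M1\<close> and \<open>M2\<close> accumulate at
    \<open>y\<close>. This point is in \<open>L\<close> but not in \<open>M2\<close>, hence in
    \<open>V\<close>; it is also in the closure of \<open>G\<close>, which is disjoint from
    \<open>V\<close>.\<close>
  obtain y where y: "y \<in> F" "\<And>m. y \<in> X closure_of (\<Union>n\<in>{m..}. F \<inter> (M1 \<inter> E n))"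
    using compact_space_sequence_accumulation[OF X(1) F(1,3)] by blast
  have "X closure_of (\<Union>n\<in>{m..}. F \<inter> (M1 \<inter> E n)) \<subseteq> X closure_of (\<Union>n\<in>{m..}. E n)" for m
    by (intro closure_of_mono) blast
  then have "y \<in> L" unfolding L_def using y(2) by blast
  moreover have "y \<notin> \<Inter>\<M>" using y(1) F(2) M2(1) by blast
  ultimately have "y \<in> V" using G(4) by blast
  have "(\<Union>n\<in>{0..}. F \<inter> (M1 \<inter> E n)) \<subseteq> G" using M1sub M(2) by blast
  then have "y \<in> X closure_of G" using y(2)[of 0] closure_of_mono by blast
  moreover have "V \<inter> X closure_of G = {}"
    using openin_Int_closure_of_eq_empty[OF G(2), of G] G(5) by (auto simp: disjnt_def)
  ultimately show False using \<open>y \<in> V\<close> by blast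
qed

subsection \<open>Regular open sets and discrete sets\<close>

definition regular_opens :: "'a topology \<Rightarrow> 'a set set"
  where "regular_opens X = {U. openin X U \<and> X interior_of (X closure_of U) = U}"

lemma interior_of_closure_of_in_regular_opens:
  "X interior_of (X closure_of U) \<in> regular_opens X"
proof -
  let ?V = "X interior_of (X closure_of U)"
  have "X closure_of ?V \<subseteq> X closure_of U"
    by (intro closure_of_minimal interior_of_subset) simp
  then have "X interior_of (X closure_of ?V) \<subseteq> ?V"
    by (rule interior_of_mono)
  moreover have "?V \<subseteq> X interior_of (X closure_of ?V)"
    by (intro interior_of_maximal closure_of_subset interior_of_subset_topspace) simp
  ultimately show ?thesis unfolding regular_opens_def by simp
qed

text \<open>Close off under this operation: for a countable family whose union is not dense, pick a
  point of countable pi-character off the closure of the union and add its local pi-base. If some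
  open set contained no member of the result, a maximal disjoint family of members missing a smaller
  open set \<open>V\<close> would be such a family, and the added local pi-base would contradict its
  maximality.\<close>

lemma ccc_pi_base_card:
  assumes "regular_space X" "ccc_space X"
    and dense: "\<And>U. \<lbrakk>openin X U; U \<noteq> {}\<rbrakk> \<Longrightarrow> \<exists>p\<in>U. countable_pi_character X p"
  obtains \<B> where "|\<B>| \<le>o |UNIV :: real set|" "\<And>B. B \<in> \<B> \<Longrightarrow> openin X B \<and> B \<noteq> {}"
    "\<And>U. \<lbrakk>openin X U; U \<noteq> {}\<rbrakk> \<Longrightarrow> \<exists>B\<in>\<B>. B \<subseteq> U"
proof -
  let ?c = "|UNIV :: real set|"
  have "\<exists>\<B>. countable \<B> \<and> (\<forall>B\<in>\<B>. openin X B \<and> B \<noteq> {}) \<and>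
      (\<forall>W. openin X W \<and> p \<in> W \<longrightarrow> (\<exists>B\<in>\<B>. B \<subseteq> W))" if "countable_pi_character X p" for p
    using that unfolding countable_pi_character_def .
  then obtain P where P: "\<And>p. countable_pi_character X p \<Longrightarrow> countable (P p) \<and>
      (\<forall>B\<in>P p. openin X B \<and> B \<noteq> {}) \<and> (\<forall>W. openin X W \<and> p \<in> W \<longrightarrow> (\<exists>B\<in>P p. B \<subseteq> W))"
    by metis
  define pick where "pick = (\<lambda>\<V>. SOME p. countable_pi_character X p \<and>
      p \<in> topspace X - X closure_of (\<Union>\<V>))"
  \<comment> \<open>\<open>pick\<close> is arbitrary when no point qualifies; the empty default
    keeps \<open>F\<close> countable in that case.\<close>
  define F where "F = (\<lambda>\<V>. if countable_pi_character X (pick \<V>) then P (pick \<V>) else {})"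
  have "countable (F \<V>)" for \<V> unfolding F_def using P by auto
  then have "|F \<V>| \<le>o ?c" for \<V> by (rule countable_imp_card_of_ordLeq_real)
  then obtain \<A> where A: "|\<A>| \<le>o ?c" "\<And>C. \<lbrakk>countable C; C \<subseteq> \<A>\<rbrakk> \<Longrightarrow> F C \<subseteq> \<A>"
    using countable_closing_off[of F] by blast
  define \<B> where "\<B> = {B \<in> \<A>. openin X B \<and> B \<noteq> {}}"
  have F_open: "openin X B \<and> B \<noteq> {}" if "B \<in> F \<V>" for B \<V>
    using that P unfolding F_def by (auto split: if_splits)
  have closed: "F C \<subseteq> \<B>" if "countable C" "C \<subseteq> \<B>" for C
    using A(2)[of C] that F_open unfolding \<B>_def by blast
  have base: "\<exists>B\<in>\<B>. B \<subseteq> U" if U: "openin X U" "U \<noteq> {}" for U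
  proof (rule ccontr)
    assume no: "\<not> (\<exists>B\<in>\<B>. B \<subseteq> U)"
    obtain p where p: "p \<in> U" using U by blast
    have "closedin X (topspace X - U)" "p \<in> topspace X - (topspace X - U)"
      using U(1) p openin_subset by auto
    then obtain V where V: "openin X V" "p \<in> V" "disjnt (topspace X - U) (X closure_of V)"
      using assms(1) unfolding regular_space by meson
    have VU: "X closure_of V \<subseteq> U"
      using V(3) closure_of_subset_topspace[of X V] by (auto simp: disjnt_def)
    obtain \<U> where \<U>: "\<U> \<subseteq> {B \<in> \<B>. disjnt B V}" "pairwise disjnt \<U>"
        "\<forall>B\<in>{B \<in> \<B>. disjnt B V}. B \<noteq> {} \<longrightarrow> (\<exists>U\<in>\<U>. \<not> disjnt U B)"
      using maximal_disjoint_subfamily[of "{B \<in> \<B>. disjnt B V}"] by (elim exE conjE)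
    have "\<forall>U\<in>\<U>. openin X U \<and> U \<noteq> {}" using \<U>(1) unfolding \<B>_def by blast
    then have "countable \<U>" using assms(2) \<U>(2) unfolding ccc_space_def by blast
    then have F\<U>: "F \<U> \<subseteq> \<B>" using closed \<U>(1) by blast
    have "V \<inter> \<Union>\<U> = {}" using \<U>(1) by (auto simp: disjnt_def)
    then have "V \<inter> X closure_of (\<Union>\<U>) = {}"
      using openin_Int_closure_of_eq_empty[OF V(1)] by blast
    moreover obtain q where "q \<in> V" "countable_pi_character X q" using dense V(1,2) by blast
    moreover have "V \<subseteq> topspace X" using V(1) openin_subset by blast
    ultimately have "countable_pi_character X q \<and> q \<in> topspace X - X closure_of (\<Union>\<U>)" by blast
    then have "countable_pi_character X (pick \<U>) \<and> pick \<U> \<in> topspace X - X closure_of (\<Union>\<U>)"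
      unfolding pick_def by (rule someI)
    then obtain x where x: "countable_pi_character X x" "x \<in> topspace X - X closure_of (\<Union>\<U>)"
        "P x \<subseteq> \<B>"
      using F\<U> unfolding F_def by auto
    have Px: "\<exists>B\<in>\<B>. B \<subseteq> W" if "openin X W" "x \<in> W" for W
      using P[OF x(1)] x(3) that by blast
    \<comment> \<open>Since \<B> contains a local pi-base at \<open>x\<close> but no subset of
      \<open>U\<close>, the point \<open>x\<close> is off \<open>U\<close> and thus off the closure
      of \<open>V\<close>. A member of \<B> then misses both \<open>V\<close> and the maximal
      family.\<close>
    have "x \<notin> U" using Px[OF U(1)] no by blast
    then have "x \<in> (topspace X - X closure_of (\<Union>\<U>)) \<inter> (topspace X - X closure_of V)"
      using x(2) VU by blast
    moreover have "openin X ((topspace X - X closure_of (\<Union>\<U>)) \<inter> (topspace X - X closure_of V))"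
      by (intro openin_Int openin_diff) auto
    ultimately obtain B where B: "B \<in> \<B>"
        "B \<subseteq> (topspace X - X closure_of (\<Union>\<U>)) \<inter> (topspace X - X closure_of V)"
      using Px by metis
    have "V \<subseteq> X closure_of V" using V(1) by (intro closure_of_subset openin_subset)
    then have "disjnt B V" using B(2) by (auto simp: disjnt_def)
    moreover have "B \<noteq> {}" using B(1) unfolding \<B>_def by blast
    ultimately obtain U' where U': "U' \<in> \<U>" "\<not> disjnt U' B" using \<U>(3) B(1) by blast
    have "\<Union>\<U> \<subseteq> topspace X" using \<U>(1) openin_subset unfolding \<B>_def by blast
    then have "\<Union>\<U> \<subseteq> X closure_of (\<Union>\<U>)" by (rule closure_of_subset)
    then show False using U' B(2) by (auto simp: disjnt_def)
  qed
  have "|\<B>| \<le>o ?c"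
    using card_of_mono1[of \<B> \<A>] A(1) ordLeq_transitive unfolding \<B>_def by blast
  then show ?thesis using base by (intro that[of \<B>]) (auto simp: \<B>_def)
qed

text \<open>A regular open set is determined by any dense open subset, such as the union of a
  maximal disjoint family of pi-base members inside it. By ccc these families are countable, so
  there are at most c^omega = c of them.\<close>

lemma ccc_regular_opens_card:
  assumes "ccc_space X" "|\<B>| \<le>o |UNIV :: real set|" "\<And>B. B \<in> \<B> \<Longrightarrow> openin X B \<and> B \<noteq> {}"
    and pi_base: "\<And>U. \<lbrakk>openin X U; U \<noteq> {}\<rbrakk> \<Longrightarrow> \<exists>B\<in>\<B>. B \<subseteq> U"
  shows "|regular_opens X| \<le>o |UNIV :: real set|"
proof -
  let ?\<C> = "{\<U>. \<U> \<subseteq> \<B> \<and> |Pow \<U>| \<le>o |UNIV :: real set|}"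
  have "U \<in> (\<lambda>\<U>. X interior_of (X closure_of (\<Union>\<U>))) ` ?\<C>" if "U \<in> regular_opens X" for U
  proof -
    have U: "openin X U" "X interior_of (X closure_of U) = U"
      using that unfolding regular_opens_def by auto
    obtain \<U> where \<U>: "\<U> \<subseteq> {B \<in> \<B>. B \<subseteq> U}" "pairwise disjnt \<U>"
        "\<forall>B\<in>{B \<in> \<B>. B \<subseteq> U}. B \<noteq> {} \<longrightarrow> (\<exists>U\<in>\<U>. \<not> disjnt U B)"
      using maximal_disjoint_subfamily[of "{B \<in> \<B>. B \<subseteq> U}"] by (elim exE conjE)
    have "\<forall>U\<in>\<U>. openin X U \<and> U \<noteq> {}" using \<U>(1) assms(3) by blast
    then have "countable \<U>" using assms(1) \<U>(2) unfolding ccc_space_def by blast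
    then have "\<U> \<in> ?\<C>" using \<U>(1) countable_imp_card_of_Pow_ordLeq_real by blast
    moreover have "X closure_of (\<Union>\<U>) = X closure_of U"
    proof
      have sub: "\<Union>\<U> \<subseteq> U" using \<U>(1) by blast
      then show "X closure_of (\<Union>\<U>) \<subseteq> X closure_of U" by (rule closure_of_mono)
      have Utop: "U \<subseteq> topspace X" using U(1) by (rule openin_subset)
      have "U - X closure_of (\<Union>\<U>) = {}"
      proof (rule ccontr)
        assume "U - X closure_of (\<Union>\<U>) \<noteq> {}"
        moreover have "openin X (U - X closure_of (\<Union>\<U>))"
          using U(1) by (intro openin_diff) auto
        ultimately obtain B where B: "B \<in> \<B>" "B \<subseteq> U - X closure_of (\<Union>\<U>)"
          using pi_base by metis
        then have "B \<in> {B \<in> \<B>. B \<subseteq> U}" "B \<noteq> {}" using assms(3) by auto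
        then obtain U' where U': "U' \<in> \<U>" "\<not> disjnt U' B" using \<U>(3) by blast
        have "\<Union>\<U> \<subseteq> X closure_of (\<Union>\<U>)"
          using sub Utop by (intro closure_of_subset) blast
        then show False using U' B(2) by (auto simp: disjnt_def)
      qed
      then show "X closure_of U \<subseteq> X closure_of (\<Union>\<U>)"
        by (intro closure_of_minimal) auto
    qed
    ultimately show ?thesis using U(2) by (metis (mono_tags, lifting) imageI)
  qed
  then have "|regular_opens X| \<le>o |(\<lambda>\<U>. X interior_of (X closure_of (\<Union>\<U>))) ` ?\<C>|"
    by (intro card_of_mono1) blast
  moreover have "|(\<lambda>\<U>. X interior_of (X closure_of (\<Union>\<U>))) ` ?\<C>| \<le>o |?\<C>|"
    by (rule card_of_image)
  moreover have "|?\<C>| \<le>o |UNIV :: real set|"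
    using assms(2) by (rule card_of_small_subsets_ordLeq_real)
  ultimately show ?thesis by (meson ordLeq_transitive)
qed

section \<open>Discrete sets: their subsets and the covers they generate\<close>

lemma discrete_in_avoid:
  assumes "discrete_in X D" "x \<in> D" "A \<subseteq> D" "x \<notin> A"
  shows "x \<notin> X closure_of A"
proof -
  obtain T where T: "openin X T" "{x} = T \<inter> D"
    using assms(1,2) unfolding discrete_in_def openin_subtopology by blast
  have "T \<inter> A \<subseteq> {x}" using assms(3) unfolding T(2) by blast
  then have "T \<inter> A = {}" using assms(4) by blast
  then have "T \<inter> X closure_of A = {}" using openin_Int_closure_of_eq_empty[OF T(1)] by blast
  then show ?thesis using T(2) by blast
qed

text \<open>For a subset \<open>A\<close> of a discrete \<open>D\<close>, the sets \<open>A\<close>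
  and \<open>D - A\<close> are separated, hence lie in disjoint open sets \<open>U\<close> and
  \<open>V\<close>. The interior of the closure of \<open>U\<close> contains \<open>A\<close> and
  still misses \<open>V\<close>, so distinct subsets need distinct regular open sets.\<close>

lemma hereditarily_normal_Pow_discrete:
  assumes "hereditarily normal_space X" and D: "discrete_in X D"
  shows "|Pow D| \<le>o |regular_opens X|"
proof -
  have "\<exists>R\<in>regular_opens X. R \<inter> D = A" if "A \<subseteq> D" for A
  proof -
    have Dtop: "D \<subseteq> topspace X" using D unfolding discrete_in_def by blast
    have "A \<inter> X closure_of (D - A) = {}" "(D - A) \<inter> X closure_of A = {}"
      using discrete_in_avoid[OF D] that by blast+
    then have "separatedin X A (D - A)"
      unfolding separatedin_def using that Dtop by blast
    then obtain U V where UV: "openin X U" "openin X V" "A \<subseteq> U" "D - A \<subseteq> V" "disjnt U V"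
      using assms(1) unfolding hereditarily_normal_separation by metis
    let ?R = "X interior_of (X closure_of U)"
    have "V \<inter> X closure_of U = {}"
      using openin_Int_closure_of_eq_empty[OF UV(2), of U] UV(5) by (auto simp: disjnt_def)
    then have "V \<inter> ?R = {}" using interior_of_subset[of X "X closure_of U"] by blast
    moreover have "U \<subseteq> ?R"
      using UV(1) by (intro interior_of_maximal closure_of_subset openin_subset)
    ultimately have "?R \<inter> D = A" using UV(3,4) that by blast
    then show ?thesis using interior_of_closure_of_in_regular_opens by blast
  qed
  then have "Pow D \<subseteq> (\<lambda>R. R \<inter> D) ` regular_opens X" by blast
  then have "|Pow D| \<le>o |(\<lambda>R. R \<inter> D) ` regular_opens X|" by (rule card_of_mono1)
  then show ?thesis using card_of_image ordLeq_transitive by blast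
qed

text \<open>A form of Shapirovskii's lemma. Run through \<open>Y\<close> along a well-order and keep
  a point unless it is in the closure of the points kept before, or in one of their sets
  \<open>B y\<close>. Discarded points are covered by construction.\<close>

lemma discrete_almost_cover:
  assumes Y: "Y \<subseteq> topspace X" and B: "\<And>x. x \<in> Y \<Longrightarrow> openin X (B x) \<and> x \<in> B x"
  obtains D where "D \<subseteq> Y" "discrete_in X D" "Y \<subseteq> X closure_of D \<union> (\<Union>x\<in>D. B x)"
proof -
  obtain r where r: "well_order_on Y r" using well_order_on by blast
  have wf: "wf (r - Id)" using r by (simp add: well_order_on_def)
  define Q where "Q = wfrec (r - Id) (\<lambda>Q x. x \<notin> X closure_of {y \<in> Y. (y, x) \<in> r - Id \<and> Q y} \<union>
      (\<Union>y\<in>{y \<in> Y. (y, x) \<in> r - Id \<and> Q y}. B y))"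
  define D where "D = {x \<in> Y. Q x}"
  define below where "below x = {y \<in> D. (y, x) \<in> r - Id}" for x
  have "Q x \<longleftrightarrow> x \<notin> X closure_of (below x) \<union> (\<Union>y\<in>below x. B y)" for x
  proof -
    have "{y \<in> Y. (y, x) \<in> r - Id \<and> cut Q (r - Id) x y} = below x"
      unfolding below_def D_def by (auto simp: cut_def)
    then show ?thesis unfolding Q_def by (subst wfrec[OF wf]) (simp flip: Q_def)
  qed
  then have D: "x \<in> D \<longleftrightarrow> x \<notin> X closure_of (below x) \<union> (\<Union>y\<in>below x. B y)" if "x \<in> Y" for x
    using that unfolding D_def by blast
  have DY: "D \<subseteq> Y" unfolding D_def by blast
  have "openin (subtopology X D) {x}" if x: "x \<in> D" for x
  proof -
    have xY: "x \<in> Y" using x DY by blast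
    \<comment> \<open>\<open>B x\<close> excludes the points kept after \<open>x\<close>, and
      removing the closure excludes those kept before it.\<close>
    let ?T = "B x - X closure_of (below x)"
    have "openin X ?T" using B[OF xY] by (intro openin_diff) auto
    moreover have "?T \<inter> D = {x}"
    proof (intro equalityI subsetI)
      fix y assume y: "y \<in> ?T \<inter> D"
      show "y \<in> {x}"
      proof (rule ccontr)
        assume "y \<notin> {x}"
        then have "(y, x) \<in> r - Id \<or> (x, y) \<in> r - Id"
          using r x y DY unfolding well_order_on_def linear_order_on_def total_on_def by blast
        then consider "y \<in> below x" | "x \<in> below y" using x y unfolding below_def by blast
        then show False
        proof cases
          case 1
          have "below x \<subseteq> X closure_of (below x)"
            using Y DY unfolding below_def by (intro closure_of_subset) blast
          then show False using 1 y by blast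
        next
          case 2
          then show False using D[of y] y DY by blast
        qed
      qed
    qed (use D[OF xY] x B[OF xY] in auto)
    ultimately show ?thesis unfolding openin_subtopology by blast
  qed
  then have "discrete_in X D" using DY Y unfolding discrete_in_def by blast
  moreover have "x \<in> X closure_of D \<union> (\<Union>x\<in>D. B x)" if "x \<in> Y" for x
  proof (cases "x \<in> D")
    case True
    then show ?thesis using B[OF that] by blast
  next
    case False
    have "below x \<subseteq> D" unfolding below_def by blast
    then have "X closure_of (below x) \<subseteq> X closure_of D" by (rule closure_of_mono)
    then show ?thesis using False D[OF that] \<open>below x \<subseteq> D\<close> by blast
  qed
  ultimately show ?thesis using DY by (intro that[of D]) auto
qed

section \<open>Counting the points of the space\<close>

theorem corollary3p3:
  fixes X :: "'a topology"
  assumes "compact_space X" and "Hausdorff_space X"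
    and "hereditarily normal_space X"
    and "ccc_space X"
    and "depth X \<le>o |UNIV :: real set|"
  shows "|topspace X| \<le>o |UNIV :: real set|"
proof -
  let ?c = "|UNIV :: real set|"
  have regular: "regular_space X"
    using assms(1,2) compact_Hausdorff_imp_regular_space by blast
  obtain \<B> where "|\<B>| \<le>o ?c" "\<And>B. B \<in> \<B> \<Longrightarrow> openin X B \<and> B \<noteq> {}"
      "\<And>U. \<lbrakk>openin X U; U \<noteq> {}\<rbrakk> \<Longrightarrow> \<exists>B\<in>\<B>. B \<subseteq> U"
    using ccc_pi_base_card[OF regular assms(4)
      hereditarily_normal_countable_pi_character[OF assms(1-3)]] by metis
  then have RO: "|regular_opens X| \<le>o ?c"
    by (rule ccc_regular_opens_card[OF assms(4)])
  \<comment> \<open>\<open>depth X\<close> is a chosen supremum; its least upper bound property,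
    transferred to the reals, bounds every single closure.\<close>
  have closure_D: "|X closure_of D| \<le>o ?c" if "discrete_in X D" for D
    using is_card_sup_ordLeq_iff[OF depth_is_card_sup card_of_Card_order] assms(5) that by blast
  have Pow_D: "|Pow D| \<le>o ?c" if "discrete_in X D" for D
    using hereditarily_normal_Pow_discrete[OF assms(3) that] RO ordLeq_transitive by blast
  let ?\<Gamma> = "{\<C>. \<C> \<subseteq> regular_opens X \<and> |Pow \<C>| \<le>o ?c}"
  \<comment> \<open>Only families with at most c uncovered points are retained. This index set does
    not depend on the point \<open>p\<close>.\<close>
  let ?\<Gamma>' = "{\<C> \<in> ?\<Gamma>. |topspace X - \<Union>\<C>| \<le>o ?c}"
  have "\<exists>\<C>\<in>?\<Gamma>'. p \<in> topspace X - \<Union>\<C>" if p: "p \<in> topspace X" for p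
  proof -
    have "\<exists>R\<in>regular_opens X. x \<in> R \<and> p \<notin> R" if x: "x \<in> topspace X - {p}" for x
    proof -
      have "closedin X {p}" using p assms(2) by (simp add: closedin_Hausdorff_singleton)
      then obtain U where U: "openin X U" "x \<in> U" "disjnt {p} (X closure_of U)"
        using regular x unfolding regular_space by meson
      have "U \<subseteq> X interior_of (X closure_of U)"
        using U(1) by (intro interior_of_maximal closure_of_subset openin_subset)
      moreover have "p \<notin> X interior_of (X closure_of U)"
        using U(3) interior_of_subset[of X "X closure_of U"] by (auto simp: disjnt_def)
      ultimately show ?thesis using U(2) interior_of_closure_of_in_regular_opens by blast
    qed
    then obtain R where R: "\<And>x. x \<in> topspace X - {p} \<Longrightarrow> R x \<in> regular_opens X \<and> x \<in> R x \<and> p \<notin> R x"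
      by metis
    have "\<And>x. x \<in> topspace X - {p} \<Longrightarrow> openin X (R x) \<and> x \<in> R x"
      using R unfolding regular_opens_def by blast
    then obtain D where D: "D \<subseteq> topspace X - {p}" "discrete_in X D"
        "topspace X - {p} \<subseteq> X closure_of D \<union> (\<Union>x\<in>D. R x)"
      using discrete_almost_cover[of "topspace X - {p}" X R] by blast
    have "|Pow (R ` D)| \<le>o |Pow D|" by (intro card_of_Pow_mono_ordLeq card_of_image)
    then have "|Pow (R ` D)| \<le>o ?c" using Pow_D[OF D(2)] ordLeq_transitive by blast
    moreover have "|topspace X - \<Union>(R ` D)| \<le>o ?c"
    proof -
      have "|{p}| \<le>o ?c" by (rule countable_imp_card_of_ordLeq_real) simp
      then have "|X closure_of D \<union> {p}| \<le>o ?c"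
        using closure_D[OF D(2)] infinite_real_set
        by (intro card_of_Un_ordLeq_infinite_Field) (auto simp: card_of_card_order_on Field_card_of)
      moreover have "topspace X - \<Union>(R ` D) \<subseteq> X closure_of D \<union> {p}" using D(3) by blast
      ultimately show ?thesis using card_of_mono1 ordLeq_transitive by blast
    qed
    moreover have "R ` D \<subseteq> regular_opens X" "p \<notin> \<Union>(R ` D)" using R D(1) by blast+
    ultimately have "R ` D \<in> ?\<Gamma>'" by simp
    then show ?thesis using \<open>p \<notin> \<Union>(R ` D)\<close> p by blast
  qed
  \<comment> \<open>The space is thus a union of at most c sets, each with at most c points.\<close>
  then have "topspace X \<subseteq> (\<Union>\<C>\<in>?\<Gamma>'. topspace X - \<Union>\<C>)" by blast
  then have "|topspace X| \<le>o |\<Union>\<C>\<in>?\<Gamma>'. topspace X - \<Union>\<C>|" by (rule card_of_mono1)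
  moreover have "|\<Union>\<C>\<in>?\<Gamma>'. topspace X - \<Union>\<C>| \<le>o ?c"
  proof -
    have "|?\<Gamma>'| \<le>o |?\<Gamma>|" by (intro card_of_mono1) blast
    then have "|?\<Gamma>'| \<le>o ?c"
      using card_of_small_subsets_ordLeq_real[OF RO] ordLeq_transitive by blast
    then show ?thesis using infinite_real_set by (intro card_of_UNION_ordLeq_infinite) auto
  qed
  ultimately show ?thesis using ordLeq_transitive by blast
qed

end
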